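(* Let $X$ and $Y$ be subsets of complete separable metric spaces, equipped with $\sigma$-finite Borel measures $\mu$ on $X$ and $\nu$ on $Y$. Suppose there is a numbered limb system $S = \bigcup_{i=1}^\infty \mathrm{Graph}(f_{2i-1}) \cup \mathrm{Antigraph}(f_{2i})\subset X\times Y$ with the property that $\mathrm{Graph}(f_{2i-1})$ and $\mathrm{Antigraph}(f_{2i})$ are $\gamma$-measurable subsets of $X \times Y$ for each $i \ge 1$, for every $\gamma \in \Gamma(\mu,\nu)$ vanishing outside of $S$. If the system has finitely many limbs or $\mu[X]<\infty$, then any measure $\gamma \in \Gamma(\mu,\nu)$ vanishing outside of $S$ is extremal in the convex set $\Gamma(\mu,\nu)$.
   Context: Measures. $\pi^X(x,y)=x$ and $\pi^Y(x,y)=y$ are the projections of $X\times Y$, and $\pi_\#\gamma[B]:=\gamma[\pi^{-1}(B)]$ is the push-forward. $\Gamma(\mu,\nu)$ denotes the set of non-negative Borel measures $\gamma$ on $X\times Y$ with marginals $\pi^X_\#\gamma=\mu$ and $\pi^Y_\#\gamma=\nu$. A measure $\gamma$ vanishes outside of $S\subset X\times Y$ if $\gamma$ assigns zero outer measure to $(X\times Y)\setminus S$. A set is $\gamma$-measurable if it belongs to the $\gamma$-completion of the Borel $\sigma$-algebra. A measure $\gamma\in\Gamma(\mu,\nu)$ is extremal if it cannot be written as $\gamma=(1-t)\gamma_0+t\gamma_1$ with $0<t<1$ and $\gamma_0,\gamma_1\in\Gamma(\mu,\nu)$, except trivially with $\gamma_0=\gamma_1$. Graphs. For a map $f$ defined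 on a set $D=\mathrm{Dom} f$, $\mathrm{Graph}(f)=\{(x,f(x)) : x\in D\}$, $\mathrm{Antigraph}(f)=\{(f(x),x) : x\in D\}$, and $\mathrm{Ran} f=f(D)$. Numbered limb system. A relation $S\subset X\times Y$ is a numbered limb system if there are countable disjoint decompositions $X=\bigcup_{i=0}^\infty I_{2i+1}$ and $Y=\bigcup_{i=0}^\infty I_{2i}$ (some $I_k$ may be empty), and a sequence of maps $f_{2i}:\mathrm{Dom}(f_{2i})\subset Y\to X$ and $f_{2i+1}:\mathrm{Dom}(f_{2i+1})\subset X\to Y$ ($i\ge 0$), such that $S=\bigcup_{i=1}^\infty \mathrm{Graph}(f_{2i-1})\cup \mathrm{Antigraph}(f_{2i})$, with $\mathrm{Dom}(f_k)\cup \mathrm{Ran}(f_{k+1})\subset I_k$ for each $k\ge 0$. (The map $f_0$ is irrelevant and may be taken to have empty domain.) The system has (at most) $N$ limbs if $\mathrm{Dom}(f_k)=\emptyset$ for all $k>N$; it has finitely many limbs if this holds for some $N<\infty$.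
   Formalization: "γ-measurable" is taken in the completion of the Borel σ-algebra of the product of the ambient complete separable spaces, not of X×Y; this matters only when X or Y is non-measurable, where the claim as worded can fail. *)

theory Defs
  imports "HOL-Analysis.Analysis"
begin

(* X and Y are arbitrary subsets of Polish spaces; their Borel sigma-algebras are those of
   the subspace topologies, e.g. sets mu = sets (restrict_space borel X).  In particular
   restrict_space borel (X \<times> Y) carries the Borel sigma-algebra of the subspace X \<times> Y.
   Membership in couplings does not assume that X or Y is a Borel set. *)

definition couplings ::
    "'a::polish_space set \<Rightarrow> 'b::polish_space set \<Rightarrow> 'a measure \<Rightarrow> 'b measure \<Rightarrow> ('a \<times> 'b) measure set"
  where "couplings X Y \<mu> \<nu> =
    {\<gamma>. sets \<gamma> = sets (restrict_space borel (X \<times> Y)) \<and>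
        distr \<gamma> (restrict_space borel X) fst = \<mu> \<and>
        distr \<gamma> (restrict_space borel Y) snd = \<nu>}"

definition vanishes_outside :: "'a measure \<Rightarrow> 'a set \<Rightarrow> bool"
  where "vanishes_outside \<gamma> S \<longleftrightarrow> outer_measure_of \<gamma> (space \<gamma> - S) = 0"

(* The Borel sigma-algebra whose completion is taken is that of the ambient Polish space, to
   which gamma is extended by B \<mapsto> gamma (B \<inter> space gamma).  When space gamma is a Borel set
   this is membership in the completion of gamma itself, see measure_measurable_iff_completion.
   For a non-measurable Y it is stronger, and the main statement fails with the weaker notion:
   take X = {1,2} \<times> [0,1] and Y = {1} \<times> A \<union> {2} \<times> ([0,1] - A), where A and its complement have
   full outer Lebesgue measure in [0,1], and S = {((i,s),(j,s)). (j,s) \<in> Y}.  This is the graph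
   of a map X \<rightarrow> Y and is closed in X \<times> Y, yet for every a \<in> [0,1] the measure with weight
   a/2 if i = j and (1-a)/2 if i \<noteq> j on the pieces {((i,s),(j,s))}, traced on X \<times> Y, vanishes
   outside S, and its marginals do not depend on a. *)

definition measure_measurable :: "'a::topological_space measure \<Rightarrow> 'a set \<Rightarrow> bool"
  where "measure_measurable \<gamma> A \<longleftrightarrow> A \<in> sets (completion (distr \<gamma> borel (\<lambda>p. p)))"

lemma measure_measurable_iff_completion:
  fixes Z :: "'a::topological_space set"
  assumes Z: "Z \<in> sets borel" and \<gamma>: "sets \<gamma> = sets (restrict_space borel Z)" and AZ: "A \<subseteq> Z"
  shows "measure_measurable \<gamma> A \<longleftrightarrow> A \<in> sets (completion \<gamma>)"
proof -
  have sp: "space \<gamma> = Z"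
    using sets_eq_imp_space_eq[OF \<gamma>] by (simp add: space_restrict_space)
  have mem: "B \<in> sets \<gamma> \<longleftrightarrow> B \<in> sets borel \<and> B \<subseteq> Z" for B
    using Z by (auto simp: \<gamma> sets_restrict_space_iff)
  have meas: "(\<lambda>p. p) \<in> measurable \<gamma> borel"
    using Z by (intro measurableI) (auto simp: sp mem)
  have em: "emeasure (distr \<gamma> borel (\<lambda>p. p)) B = emeasure \<gamma> (B \<inter> Z)" if "B \<in> sets borel" for B
    using emeasure_distr[OF meas that] by (simp add: sp)
  show ?thesis
  proof
    assume "measure_measurable \<gamma> A"
    then obtain S N N' where *: "A = S \<union> N" "N \<subseteq> N'" "N' \<in> null_sets (distr \<gamma> borel (\<lambda>p. p))"
        "S \<in> sets (distr \<gamma> borel (\<lambda>p. p))"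
      unfolding measure_measurable_def by (elim sets_completionE)
    then have "N' \<inter> Z \<in> null_sets \<gamma>"
      using Z by (auto simp: null_sets_def em mem)
    moreover have "S \<in> sets \<gamma>" "N \<subseteq> N' \<inter> Z"
      using * AZ by (auto simp: mem)
    ultimately show "A \<in> sets (completion \<gamma>)"
      using \<open>A = S \<union> N\<close> by (intro sets_completionI)
  next
    assume "A \<in> sets (completion \<gamma>)"
    then obtain S N N' where *: "A = S \<union> N" "N \<subseteq> N'" "N' \<in> null_sets \<gamma>" "S \<in> sets \<gamma>"
      by (elim sets_completionE)
    then have "N' \<in> null_sets (distr \<gamma> borel (\<lambda>p. p))"
      by (auto simp: null_sets_def em mem Int_absorb2)
    with * show "measure_measurable \<gamma> A"
      unfolding measure_measurable_def
      by (intro sets_completionI[where S = S and N = N and N' = N']) (auto simp: mem)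
  qed
qed

definition extremal_in :: "'a measure \<Rightarrow> 'a measure set \<Rightarrow> bool"
  where "extremal_in \<gamma> G \<longleftrightarrow> \<gamma> \<in> G \<and>
    (\<forall>t \<gamma>0 \<gamma>1. 0 < t \<and> t < (1::real) \<and> \<gamma>0 \<in> G \<and> \<gamma>1 \<in> G \<and>
       (\<forall>B\<in>sets \<gamma>. emeasure \<gamma> B = ennreal (1 - t) * emeasure \<gamma>0 B + ennreal t * emeasure \<gamma>1 B)
       \<longrightarrow> \<gamma>0 = \<gamma>1)"

definition antigraph :: "('b \<rightharpoonup> 'a) \<Rightarrow> ('a \<times> 'b) set"
  where "antigraph f = {(x, y). f y = Some x}"

(* The odd-numbered objects I_k, f_k and the even-numbered ones have different types, so the
   sequence I_0, I_1, ... is given as two sequences I, J and f_0, f_1, ... as f, g: the odd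
   indices are read from I and f, the even ones from J and g, with the numbering unchanged.
   The values of I, f at even and of J, g at odd indices are never used. *)

definition limb_union :: "(nat \<Rightarrow> 'a \<rightharpoonup> 'b) \<Rightarrow> (nat \<Rightarrow> 'b \<rightharpoonup> 'a) \<Rightarrow> ('a \<times> 'b) set"
  where "limb_union f g = (\<Union>i\<in>{1..}. Map.graph (f (2 * i - 1)) \<union> antigraph (g (2 * i)))"

definition numbered_limb_system ::
    "'a set \<Rightarrow> 'b set \<Rightarrow> (nat \<Rightarrow> 'a set) \<Rightarrow> (nat \<Rightarrow> 'b set) \<Rightarrow>
     (nat \<Rightarrow> 'a \<rightharpoonup> 'b) \<Rightarrow> (nat \<Rightarrow> 'b \<rightharpoonup> 'a) \<Rightarrow> ('a \<times> 'b) set \<Rightarrow> bool"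
  where "numbered_limb_system X Y I J f g S \<longleftrightarrow>
    X = (\<Union>i. I (2 * i + 1)) \<and> disjoint_family (\<lambda>i. I (2 * i + 1)) \<and>
    Y = (\<Union>i. J (2 * i)) \<and> disjoint_family (\<lambda>i. J (2 * i)) \<and>
    (\<forall>i. dom (f (2 * i + 1)) \<subseteq> X \<and> ran (f (2 * i + 1)) \<subseteq> Y) \<and>
    (\<forall>i. dom (g (2 * i)) \<subseteq> Y \<and> ran (g (2 * i)) \<subseteq> X) \<and>
    (\<forall>k. odd k \<longrightarrow> dom (f k) \<union> ran (g (k + 1)) \<subseteq> I k) \<and>
    (\<forall>k. even k \<longrightarrow> dom (g k) \<union> ran (f (k + 1)) \<subseteq> J k) \<and>
    S = limb_union f g"

definition at_most_limbs :: "nat \<Rightarrow> (nat \<Rightarrow> 'a \<rightharpoonup> 'b) \<Rightarrow> (nat \<Rightarrow> 'b \<rightharpoonup> 'a) \<Rightarrow> bool"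
  where "at_most_limbs N f g \<longleftrightarrow>
    (\<forall>k>N. (odd k \<longrightarrow> dom (f k) = {}) \<and> (even k \<longrightarrow> dom (g k) = {}))"

definition finitely_many_limbs :: "(nat \<Rightarrow> 'a \<rightharpoonup> 'b) \<Rightarrow> (nat \<Rightarrow> 'b \<rightharpoonup> 'a) \<Rightarrow> bool"
  where "finitely_many_limbs f g \<longleftrightarrow> (\<exists>N. at_most_limbs N f g)"

end

theory Submission
  imports Defs
begin

text \<open>Two couplings \<open>\<gamma>\<^sub>0, \<gamma>\<^sub>1\<close> that occur in a convex decomposition of \<open>\<gamma>\<close> are absolutely continuous with
  respect to \<open>\<gamma>\<close>, so they are carried by the limbs as well. Let \<open>\<sigma> = \<gamma>\<^sub>0 - \<gamma>\<^sub>1\<close> and let \<open>a\<^sub>k\<close> be the mass of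
  \<open>\<bar>\<sigma>\<bar>\<close> on the limb \<open>k\<close>. Over the domain of the k-th map there are only points of the limbs \<open>k\<close> and
  \<open>k + 1\<close>, and the limb \<open>k\<close> is a graph there; as the marginals of \<open>\<sigma>\<close> vanish, what \<open>\<sigma>\<close> puts on the limb \<open>k\<close>
  is cancelled by the limb \<open>k + 1\<close>, so \<open>a\<^sub>k \<le> a\<^sub>k\<^sub>+\<^sub>1\<close>. If there are finitely many limbs, or if the
  \<open>a\<^sub>k\<close> have a finite sum, then all \<open>a\<^sub>k\<close> vanish.\<close>

section \<open>The variation of the difference of two measures with equal marginals\<close>

text \<open>A finite measure with a strictly positive density with respect to \<open>m\<close> has
  the same null sets as \<open>m\<close>, and finite Borel measures on a Polish space are inner
  regular with respect to compact sets.\<close>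

lemma sigma_compact_core:
  fixes m :: "'c::{second_countable_topology, complete_space} measure"
  assumes sigma: "sigma_finite_measure m" and sets_m: "sets m = sets borel" and B: "B \<in> sets borel"
  obtains C :: "nat \<Rightarrow> 'c set"
  where "\<And>i. compact (C i)" "\<And>i. C i \<subseteq> B" "B - (\<Union>i. C i) \<in> null_sets m"
proof -
  interpret sigma_finite_measure m by fact
  have space_m: "space m = UNIV"
    using sets_eq_imp_space_eq[OF sets_m] by simp
  obtain h where h: "h \<in> borel_measurable m" "integral\<^sup>N m h \<noteq> \<infinity>"
    and h_pos: "\<And>x. 0 < h x \<and> h x < \<infinity>"
    using Ex_finite_integrable_function by (auto simp: space_m)
  define n where "n = density m h"
  have sets_n: "sets n = sets borel" and space_n: "space n = UNIV"
    by (auto simp: n_def sets_m space_m)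
  have "emeasure n (space n) = integral\<^sup>N m h"
    using emeasure_density[OF h(1) sets.top] by (simp add: n_def space_m)
  then have fin: "emeasure n (space n) \<noteq> \<infinity>"
    using h by simp
  then interpret n: finite_measure n
    by (rule finite_measureI)
  have inner: "emeasure n B = (SUP K\<in>{K. K \<subseteq> B \<and> compact K}. emeasure n K)"
    by (rule inner_regular[OF sets_n fin B])
  have "\<exists>C. (\<forall>i::nat. C i \<in> {K. K \<subseteq> B \<and> compact K}) \<and>
      (SUP K\<in>{K. K \<subseteq> B \<and> compact K}. emeasure n K) = (SUP i. emeasure n (C i))"
  proof -
    have "{K. K \<subseteq> B \<and> compact K} \<noteq> {}"
      by (auto intro: exI[of _ "{}"])
    from ennreal_SUP_countable_SUP[OF this, of "emeasure n"]
    obtain F where F: "range F \<subseteq> emeasure n ` {K. K \<subseteq> B \<and> compact K}"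
      "(SUP K\<in>{K. K \<subseteq> B \<and> compact K}. emeasure n K) = (SUP i::nat. F i)"
      by metis
    then have "\<forall>i. \<exists>K. K \<in> {K. K \<subseteq> B \<and> compact K} \<and> F i = emeasure n K"
      by blast
    then obtain C where "\<And>i. C i \<in> {K. K \<subseteq> B \<and> compact K} \<and> F i = emeasure n (C i)"
      by metis
    with F(2) show ?thesis
      by (intro exI[of _ C]) auto
  qed
  then obtain C where C_all: "\<forall>i::nat. C i \<in> {K. K \<subseteq> B \<and> compact K}"
    and C_sup: "(SUP K\<in>{K. K \<subseteq> B \<and> compact K}. emeasure n K) = (SUP i. emeasure n (C i))"
    by (elim exE conjE)
  have C: "compact (C i)" "C i \<subseteq> B" for i
    using C_all by auto
  have sup: "emeasure n B = (SUP i. emeasure n (C i))"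
    unfolding inner C_sup ..
  have C_sets: "C i \<in> sets borel" for i
    using C(1) by (simp add: borel_compact)
  have U: "(\<Union>i. C i) \<in> sets borel"
    using C_sets by auto
  \<comment> \<open>The sequence need not increase: the union has at least the mass of each member,
    hence that of \<open>B\<close>.\<close>
  have "emeasure n B \<le> emeasure n (\<Union>i. C i)"
    unfolding sup using U by (intro SUP_least emeasure_mono) (auto simp: sets_n)
  moreover have "emeasure n (B - (\<Union>i. C i)) = emeasure n B - emeasure n (\<Union>i. C i)"
    using U B C(2) by (intro emeasure_Diff) (auto simp: sets_n)
  ultimately have "emeasure n (B - (\<Union>i. C i)) = 0"
    by (simp add: diff_eq_0_iff_ennreal less_top[symmetric])
  then have "B - (\<Union>i. C i) \<in> null_sets n"
    using U B by (auto simp: null_sets_def sets_n)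
  then have "AE x in m. x \<in> B - (\<Union>i. C i) \<longrightarrow> h x = 0"
    using null_sets_density_iff[OF h(1)] by (auto simp: n_def)
  then have "AE x in m. x \<notin> B - (\<Union>i. C i)"
    by (rule eventually_mono) (metis h_pos less_irrefl)
  then have "B - (\<Union>i. C i) \<in> null_sets m"
    using U B by (subst AE_iff_null_sets) (auto simp: sets_m)
  with C that show thesis by blast
qed

text \<open>\<tau> is the total variation of m0 - m1 and P the positive set of its Hahn decomposition. Neither m0
  nor m1 need be finite, so the identities are stated without differences.\<close>

lemma variation_measure_exists:
  assumes "sigma_finite_measure m" "sets m0 = sets m" "sets m1 = sets m"
    and "absolutely_continuous m m0" "absolutely_continuous m m1"
  obtains \<tau> P where "sets \<tau> = sets m" "P \<in> sets m" "absolutely_continuous m \<tau>"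
    "\<And>B. B \<in> sets m \<Longrightarrow> emeasure m0 B \<le> emeasure m1 B + emeasure \<tau> B"
    "\<And>B. B \<in> sets m \<Longrightarrow> emeasure m1 B \<le> emeasure m0 B + emeasure \<tau> B"
    "\<And>B. B \<in> sets m \<Longrightarrow> B \<subseteq> P \<Longrightarrow> emeasure m0 B = emeasure m1 B + emeasure \<tau> B"
    "\<And>B. B \<in> sets m \<Longrightarrow> B \<inter> P = {} \<Longrightarrow> emeasure m1 B = emeasure m0 B + emeasure \<tau> B"
proof -
  interpret sigma_finite_measure m by fact
  define u v where "u = RN_deriv m m0" and "v = RN_deriv m m1"
  have [measurable]: "u \<in> borel_measurable m" "v \<in> borel_measurable m"
    by (auto simp: u_def v_def)
  have dens: "density m u = m0" "density m v = m1"
    using assms by (auto simp: u_def v_def density_RN_deriv)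
  \<comment> \<open>\<open>w\<close> is the absolute value of \<open>u - v\<close>. As only
    \<open>m\<close> is assumed \<sigma>-finite, the densities may be infinite; subtracting the
    smaller from the larger keeps the sums in \<open>eq\<close> valid at such points too.\<close>
  define w where "w x = (if v x < u x then u x - v x else v x - u x)" for x
  have [measurable]: "w \<in> borel_measurable m"
    unfolding w_def by measurable
  define P where "P = {x\<in>space m. v x < u x}"
  have P: "P \<in> sets m"
    unfolding P_def by measurable
  have le: "u x \<le> v x + w x" "v x \<le> u x + w x" for x
    by (auto simp: w_def diff_add_cancel_ennreal add.commute[of _ "_ - _"] not_less
        intro: order_trans[OF less_imp_le] add_increasing)
  have eq: "v x < u x \<Longrightarrow> u x = v x + w x" "\<not> v x < u x \<Longrightarrow> v x = u x + w x" for x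
    by (auto simp: w_def diff_add_cancel_ennreal add.commute[of _ "_ - _"])
  have m0: "emeasure m0 B = (\<integral>\<^sup>+x. u x * indicator B x \<partial>m)"
    and m1: "emeasure m1 B = (\<integral>\<^sup>+x. v x * indicator B x \<partial>m)"
    and t: "emeasure (density m w) B = (\<integral>\<^sup>+x. w x * indicator B x \<partial>m)" if "B \<in> sets m" for B
    using that by (auto simp flip: dens simp: emeasure_density)
  show thesis
  proof (rule that[of "density m w" P])
    fix B assume B[measurable]: "B \<in> sets m"
    show "emeasure m0 B \<le> emeasure m1 B + emeasure (density m w) B"
      unfolding m0[OF B] m1[OF B] t[OF B] using le(1)
      by (subst nn_integral_add[symmetric]) (auto intro!: nn_integral_mono split: split_indicator)
    show "emeasure m1 B \<le> emeasure m0 B + emeasure (density m w) B"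
      unfolding m0[OF B] m1[OF B] t[OF B] using le(2)
      by (subst nn_integral_add[symmetric]) (auto intro!: nn_integral_mono split: split_indicator)
    show "emeasure m0 B = emeasure m1 B + emeasure (density m w) B" if "B \<subseteq> P"
      unfolding m0[OF B] m1[OF B] t[OF B] using eq(1) that
      by (subst nn_integral_add[symmetric])
        (auto intro!: nn_integral_cong simp: P_def split: split_indicator)
    show "emeasure m1 B = emeasure m0 B + emeasure (density m w) B" if "B \<inter> P = {}"
      unfolding m0[OF B] m1[OF B] t[OF B] using eq(2) that
      by (subst nn_integral_add[symmetric])
        (fastforce intro!: nn_integral_cong simp: P_def split: split_indicator)+
  qed (use P in \<open>auto intro: absolutely_continuousI_density\<close>)
qed

section \<open>Transfer of variation along the fibres of a projection\<close>

text \<open>Borel sets can have non-Borel projections, but a continuous image of a compact set is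
  compact, hence closed in a Hausdorff space.\<close>

lemma continuous_image_sigma_compact_borel:
  fixes p :: "'c::topological_space \<Rightarrow> 'd::t2_space"
  assumes p: "continuous_on UNIV p" and C: "\<And>i::nat. compact (C i)"
  shows "p ` (\<Union>i. C i) \<in> sets borel"
proof -
  have "compact (p ` C i)" for i
    using C p by (blast intro: compact_continuous_image continuous_on_subset)
  then show ?thesis
    unfolding image_UN by (intro sets.countable_UN) (auto intro: borel_compact)
qed

text \<open>Read \<open>a\<close>, \<open>r\<close> as the masses of one measure on a set and on the
  rest of its fibres, and \<open>b\<close>, \<open>s\<close> as those of another. An excess
  \<open>x\<close> on the set is a deficit on the rest, which \<open>y\<close> bounds. Since
  \<open>b + r\<close> is finite, it can be cancelled.\<close>

lemma ennreal_balance: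
  fixes a b x r s y :: ennreal
  assumes "a + r = b + s" "a = b + x" "s \<le> r + y" "r < \<infinity>" "a < \<infinity>"
  shows "x \<le> y"
proof -
  have "(b + r) + x = b + s"
    using assms(1) unfolding assms(2) by (simp add: ac_simps)
  also have "\<dots> \<le> (b + r) + y"
    using assms(3) by (simp add: add.assoc add_left_mono)
  finally show ?thesis
    using assms by (auto simp: ennreal_add_left_cancel_le)
qed

text \<open>On the union \<open>K\<close> of the \<open>C i\<close> the measure \<open>m0\<close>
  exceeds \<open>m1\<close> by \<open>\<tau>\<close>. Over the projection of \<open>K\<close> both
  measures live on \<open>K\<close> and \<open>A'\<close> and, by the equal marginals, have the same
  mass there. So \<open>m1\<close> makes up for the excess on \<open>A'\<close>, and
  \<open>\<tau>\<close> bounds its gain.\<close>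

lemma variation_le_part:
  fixes m0 m1 \<tau> :: "'c::topological_space measure"
    and p :: "'c \<Rightarrow> 'd::{second_countable_topology, t2_space}"
  assumes sets: "sets m0 = sets borel" "sets m1 = sets borel" "sets \<tau> = sets borel"
    and p: "continuous_on UNIV p"
    and marg: "distr m0 borel p = distr m1 borel p" and sigma: "sigma_finite_measure (distr m0 borel p)"
    and C: "\<And>i::nat. compact (C i)" "\<And>i. C i \<in> sets borel"
    and A': "A' \<in> sets borel"
    and disj: "(\<Union>i. C i) \<inter> A' = {}"
    and ae: "AE c in m0. p c \<in> p ` (\<Union>i. C i) \<longrightarrow> c \<in> (\<Union>i. C i) \<union> A'"
      "AE c in m1. p c \<in> p ` (\<Union>i. C i) \<longrightarrow> c \<in> (\<Union>i. C i) \<union> A'"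
    and pos: "\<And>B. B \<in> sets borel \<Longrightarrow> B \<subseteq> (\<Union>i. C i) \<Longrightarrow> emeasure m0 B = emeasure m1 B + emeasure \<tau> B"
    and le: "\<And>B. B \<in> sets borel \<Longrightarrow> emeasure m1 B \<le> emeasure m0 B + emeasure \<tau> B"
  shows "emeasure \<tau> (\<Union>i. C i) \<le> emeasure \<tau> (A' \<inter> p -` p ` (\<Union>i. C i))"
proof -
  have space: "space m0 = UNIV" "space m1 = UNIV" "space \<tau> = UNIV"
    using sets[THEN sets_eq_imp_space_eq] by auto
  have p_borel[measurable]: "p \<in> borel_measurable borel"
    using p by (rule borel_measurable_continuous_onI)
  then have p_meas: "p \<in> borel_measurable m0" "p \<in> borel_measurable m1"
    using sets by (simp_all cong: measurable_cong_sets)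
  define K where "K = (\<Union>i. C i)"
  have K[measurable]: "K \<in> sets borel"
    using C(2) by (auto simp: K_def)
  have [measurable]: "p ` K \<in> sets borel"
    unfolding K_def using p C(1) by (rule continuous_image_sigma_compact_borel)
  interpret mu: sigma_finite_measure "distr m0 borel p" by fact
  \<comment> \<open>Cancellation requires finite masses, so the base is exhausted by sets of finite
    marginal mass; a monotone limit then gives the bound for \<open>K\<close>.\<close>
  obtain E :: "nat \<Rightarrow> 'd set" where E: "range E \<subseteq> sets (distr m0 borel p)"
    "(\<Union>i. E i) = space (distr m0 borel p)" "\<And>i. emeasure (distr m0 borel p) (E i) \<noteq> \<infinity>" "incseq E"
    using mu.sigma_finite_incseq by blast
  have E_sets[measurable]: "E n \<in> sets borel" for n
    using E(1) by auto
  have m0_fin: "emeasure m0 (p -` E n) \<noteq> \<infinity>" for n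
    using E(3)[of n] p_meas(1) by (simp add: emeasure_distr space)
  have meas_K: "K \<inter> p -` E n \<in> sets borel" for n
  proof -
    have "K \<inter> p -` E n = {c \<in> space borel. c \<in> K \<and> p c \<in> E n}" by auto
    also have "\<dots> \<in> sets borel" by measurable
    finally show ?thesis .
  qed
  have meas_p: "p -` D \<in> sets borel" if "D \<in> sets borel" for D
    using measurable_sets[OF p_borel that] by simp
  have part: "emeasure \<tau> (K \<inter> p -` E n) \<le> emeasure \<tau> (A' \<inter> p -` p ` K)" for n
  proof -
    define D where "D = p ` K \<inter> E n"
    have D: "D \<in> sets borel" unfolding D_def by measurable
    define R where "R = A' \<inter> p -` D"
    have R: "R \<in> sets borel" unfolding R_def using meas_p[OF D] A' by auto
    have fin: "emeasure m0 B < \<infinity>" if "B \<subseteq> p -` E n" for B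
      using m0_fin[of n] emeasure_mono[OF that, of m0] meas_p[OF E_sets]
      by (auto simp: sets top.not_eq_extremum intro: le_less_trans)
    \<comment> \<open>Almost all mass over \<open>D\<close> lies in \<open>K\<close> or
      \<open>A'\<close>, and a point of \<open>K\<close> is over \<open>D\<close> exactly if it is
      over \<open>E n\<close>.\<close>
    have fibre: "emeasure m' (p -` D) = emeasure m' (K \<inter> p -` E n) + emeasure m' R"
      if m': "sets m' = sets borel" and ae': "AE c in m'. p c \<in> p ` K \<longrightarrow> c \<in> K \<union> A'"
      for m' :: "'c measure"
    proof -
      have "emeasure m' (p -` D) = emeasure m' ((K \<inter> p -` E n) \<union> R)"
        using ae' meas_p[OF D] meas_K R
        by (intro emeasure_eq_AE) (auto simp: D_def R_def m' elim!: eventually_mono)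
      also have "\<dots> = emeasure m' (K \<inter> p -` E n) + emeasure m' R"
        using disj meas_K R by (intro plus_emeasure[symmetric]) (auto simp: m' R_def K_def)
      finally show ?thesis .
    qed
    have "emeasure m0 (p -` D) = emeasure (distr m0 borel p) D"
      using p_meas(1) D by (simp add: emeasure_distr space)
    also have "\<dots> = emeasure m1 (p -` D)"
      using p_meas(2) D by (simp add: marg emeasure_distr space)
    finally have "emeasure m0 (K \<inter> p -` E n) + emeasure m0 R
        = emeasure m1 (K \<inter> p -` E n) + emeasure m1 R"
      using fibre[OF sets(1)] fibre[OF sets(2)] ae by (simp add: K_def)
    moreover have "emeasure m0 (K \<inter> p -` E n) = emeasure m1 (K \<inter> p -` E n) + emeasure \<tau> (K \<inter> p -` E n)"
      using meas_K by (intro pos) (auto simp: K_def)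
    moreover have "emeasure m1 R \<le> emeasure m0 R + emeasure \<tau> R"
      using R by (rule le)
    moreover have "emeasure m0 R < \<infinity>" "emeasure m0 (K \<inter> p -` E n) < \<infinity>"
      by (rule fin, force simp: R_def D_def)+
    ultimately have "emeasure \<tau> (K \<inter> p -` E n) \<le> emeasure \<tau> R"
      by (rule ennreal_balance)
    also have "\<dots> \<le> emeasure \<tau> (A' \<inter> p -` p ` K)"
      using A' meas_p by (intro emeasure_mono) (auto simp: R_def D_def sets)
    finally show ?thesis .
  qed
  have "K = K \<inter> p -` (\<Union>n. E n)"
    using E(2) by simp
  then have "K = (\<Union>n. K \<inter> p -` E n)"
    by blast
  then have "emeasure \<tau> K = emeasure \<tau> (\<Union>n. K \<inter> p -` E n)"
    by simp
  also have "\<dots> = (SUP n. emeasure \<tau> (K \<inter> p -` E n))"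
    using meas_K E(4) by (intro SUP_emeasure_incseq[symmetric]) (auto simp: sets incseq_def)
  also have "\<dots> \<le> emeasure \<tau> (A' \<inter> p -` p ` K)"
    by (intro SUP_least part)
  finally show ?thesis
    unfolding K_def .
qed


text \<open>The Hahn decomposition cuts A into two parts on which the sign of m0 - m1 is constant. Replacing
  these by \<open>\<sigma>\<close>-compact sets makes their projections Borel, and the projections are disjoint because
  p is injective on A. No measurability of the map with graph A is needed.\<close>

lemma variation_le_next:
  fixes m m0 m1 \<tau> :: "'c::{second_countable_topology, complete_space} measure"
    and p :: "'c \<Rightarrow> 'd::{second_countable_topology, t2_space}"
  assumes sets: "sets m = sets borel" "sets m0 = sets borel" "sets m1 = sets borel" "sets \<tau> = sets borel"
    and sigma_m: "sigma_finite_measure m"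
    and ac: "absolutely_continuous m m0" "absolutely_continuous m m1" "absolutely_continuous m \<tau>"
    and p: "continuous_on UNIV p"
    and marg: "distr m0 borel p = distr m1 borel p" and sigma: "sigma_finite_measure (distr m0 borel p)"
    and P: "P \<in> sets borel" and A: "A \<in> sets borel" and A': "A' \<in> sets borel"
    and disj: "A \<inter> A' = {}" and inj: "inj_on p A"
    and ae: "AE c in m. p c \<in> p ` A \<longrightarrow> c \<in> A \<union> A'"
    and le: "\<And>B. B \<in> sets borel \<Longrightarrow> emeasure m0 B \<le> emeasure m1 B + emeasure \<tau> B"
      "\<And>B. B \<in> sets borel \<Longrightarrow> emeasure m1 B \<le> emeasure m0 B + emeasure \<tau> B"
    and eq: "\<And>B. B \<in> sets borel \<Longrightarrow> B \<subseteq> P \<Longrightarrow> emeasure m0 B = emeasure m1 B + emeasure \<tau> B"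
      "\<And>B. B \<in> sets borel \<Longrightarrow> B \<inter> P = {} \<Longrightarrow> emeasure m1 B = emeasure m0 B + emeasure \<tau> B"
  shows "emeasure \<tau> A \<le> emeasure \<tau> A'"
proof -
  have AP: "A \<inter> P \<in> sets borel" "A - P \<in> sets borel"
    using A P by auto
  obtain C where C: "\<And>i::nat. compact (C i)" "\<And>i. C i \<subseteq> A \<inter> P" "A \<inter> P - (\<Union>i. C i) \<in> null_sets m"
    using sigma_compact_core[OF sigma_m sets(1) AP(1)] by blast
  obtain D where D: "\<And>i::nat. compact (D i)" "\<And>i. D i \<subseteq> A - P" "A - P - (\<Union>i. D i) \<in> null_sets m"
    using sigma_compact_core[OF sigma_m sets(1) AP(2)] by blast
  define U V where "U = (\<Union>i. C i)" and "V = (\<Union>i. D i)"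
  have CD_sets: "C i \<in> sets borel" "D i \<in> sets borel" for i
    using C(1) D(1) by (auto intro: borel_compact)
  have UV_sets: "U \<in> sets borel" "V \<in> sets borel"
    using CD_sets by (auto simp: U_def V_def)
  have U: "U \<subseteq> A \<inter> P" and V: "V \<subseteq> A - P"
    using C(2) D(2) unfolding U_def V_def by blast+
  have p_borel: "p \<in> borel_measurable borel"
    using p by (rule borel_measurable_continuous_onI)
  have vimg: "p -` p ` U \<in> sets borel" "p -` p ` V \<in> sets borel"
    using measurable_sets[OF p_borel continuous_image_sigma_compact_borel[OF p C(1)]]
      measurable_sets[OF p_borel continuous_image_sigma_compact_borel[OF p D(1)]]
    by (simp_all add: U_def V_def)
  \<comment> \<open>By injectivity of \<open>p\<close> on \<open>A\<close>, a point of
    \<open>A\<close> over the projection of \<open>W\<close> belongs to \<open>W\<close>; so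
    \<open>A\<close> can be shrunk to \<open>W\<close> in the condition on the fibres.\<close>
  have aeW: "AE c in m'. p c \<in> p ` W \<longrightarrow> c \<in> W \<union> A'"
    if "absolutely_continuous m m'" "sets m' = sets borel" "W \<subseteq> A" for m' W
  proof -
    have "AE c in m'. p c \<in> p ` A \<longrightarrow> c \<in> A \<union> A'"
      using absolutely_continuous_AE[OF _ that(1) ae] that(2) sets(1) by simp
    then show ?thesis
      by (rule eventually_mono) (use that(3) inj in \<open>auto dest!: inj_onD\<close>)
  qed
  define N where "N = (A \<inter> P - U) \<union> (A - P - V)"
  have "N \<in> null_sets \<tau>"
    using C(3) D(3) ac(3) by (auto simp: N_def absolutely_continuous_def U_def V_def)
  moreover have "A = (U \<union> V) \<union> N"
    using U V by (auto simp: N_def)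
  ultimately have "emeasure \<tau> A = emeasure \<tau> (U \<union> V)"
    using UV_sets by (simp add: emeasure_Un_null_set sets)
  also have "\<dots> \<le> emeasure \<tau> U + emeasure \<tau> V"
    using UV_sets by (intro emeasure_subadditive) (auto simp: sets)
  also have "\<dots> \<le> emeasure \<tau> (A' \<inter> p -` p ` U) + emeasure \<tau> (A' \<inter> p -` p ` V)"
  proof (rule add_mono)
    have sub: "U \<subseteq> A" "V \<subseteq> A" and disj': "U \<inter> A' = {}" "V \<inter> A' = {}"
      using U V disj by auto
    show "emeasure \<tau> U \<le> emeasure \<tau> (A' \<inter> p -` p ` U)"
    proof (rule variation_le_part[where C=C, OF sets(2-4) p marg sigma C(1) CD_sets(1) A', folded U_def])
      show "emeasure m0 B = emeasure m1 B + emeasure \<tau> B" if "B \<in> sets borel" "B \<subseteq> U" for B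
        using that U by (intro eq) auto
    qed (use disj' aeW[OF ac(1) sets(2)] aeW[OF ac(2) sets(3)] sub le in auto)
    \<comment> \<open>Off \<open>P\<close> it is \<open>m1\<close> that exceeds \<open>m0\<close>,
      so the two measures change places.\<close>
    show "emeasure \<tau> V \<le> emeasure \<tau> (A' \<inter> p -` p ` V)"
    proof (rule variation_le_part[where C=D, OF sets(3,2,4) p marg[symmetric] sigma[unfolded marg] D(1) CD_sets(2) A',
            folded V_def])
      show "emeasure m1 B = emeasure m0 B + emeasure \<tau> B" if "B \<in> sets borel" "B \<subseteq> V" for B
        using that V by (intro eq) auto
    qed (use disj' aeW[OF ac(1) sets(2)] aeW[OF ac(2) sets(3)] sub le in auto)
  qed
  also have "\<dots> = emeasure \<tau> (A' \<inter> p -` p ` U \<union> A' \<inter> p -` p ` V)"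
  proof (intro plus_emeasure)
    have "U \<inter> V = {}"
      using U V by auto
    then have "p ` U \<inter> p ` V = {}"
      using inj_on_image_Int[OF inj, of U V] U V by auto
    then show "A' \<inter> p -` p ` U \<inter> (A' \<inter> p -` p ` V) = {}"
      by blast
  qed (use vimg A' in \<open>auto simp: sets\<close>)
  also have "\<dots> \<le> emeasure \<tau> A'"
    using A' by (intro emeasure_mono) (auto simp: sets)
  finally show ?thesis .
qed

section \<open>Numbered limb systems\<close>

text \<open>As subsets of one product, the graphs and antigraphs of maps of different types form a
  single sequence, along which masses can be compared.\<close>

definition limb :: "(nat \<Rightarrow> 'a \<rightharpoonup> 'b) \<Rightarrow> (nat \<Rightarrow> 'b \<rightharpoonup> 'a) \<Rightarrow> nat \<Rightarrow> ('a \<times> 'b) set"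
  where "limb f g k = (if odd k then Map.graph (f k) else antigraph (g k))"

lemma inj_on_fst_graph: "inj_on fst (Map.graph h)"
  by (auto simp: inj_on_def Map.graph_def)

lemma inj_on_snd_antigraph: "inj_on snd (antigraph h)"
  by (auto simp: inj_on_def antigraph_def)

text \<open>The union begins with index 1, hence the shift: for even \<open>k\<close> the limb
  \<open>Suc k\<close> is a graph, for odd \<open>k\<close> an antigraph. With
  \<open>i = Suc j\<close>, the indices \<open>2 * i - 1\<close> and \<open>2 * i\<close> are
  \<open>Suc (2 * j)\<close> and \<open>Suc (Suc (2 * j))\<close>.\<close>

lemma limb_union_eq: "limb_union f g = (\<Union>k. limb f g (Suc k))"
proof (intro equalityI subsetI)
  fix c assume "c \<in> limb_union f g"
  then obtain i where i: "1 \<le> i" "c \<in> Map.graph (f (2 * i - 1)) \<union> antigraph (g (2 * i))"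
    by (auto simp: limb_union_def)
  obtain j where "i = Suc j"
    using i(1) by (cases i) auto
  with i(2) have "c \<in> limb f g (Suc (2 * j)) \<or> c \<in> limb f g (Suc (Suc (2 * j)))"
    by (auto simp: limb_def)
  then show "c \<in> (\<Union>k. limb f g (Suc k))"
    by blast
next
  fix c assume "c \<in> (\<Union>k. limb f g (Suc k))"
  then obtain k where k: "c \<in> limb f g (Suc k)"
    by blast
  show "c \<in> limb_union f g"
  proof (cases "even k")
    case True
    then obtain j where "k = 2 * j" ..
    with k show ?thesis
      by (auto simp: limb_def limb_union_def intro!: bexI[of _ "Suc j"])
  next
    case False
    then obtain j where "k = 2 * j + 1" by (rule oddE)
    with k show ?thesis
      by (auto simp: limb_def limb_union_def intro!: bexI[of _ "Suc j"])
  qed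
qed

context
  fixes X :: "'a set" and Y :: "'b set" and I J f g S
  assumes limbs: "numbered_limb_system X Y I J f g S"
begin

lemma limb_even:
  assumes "even k" "c \<in> limb f g (Suc k)"
  shows "fst c \<in> I (Suc k) \<and> snd c \<in> J k"
proof -
  have "dom (f (Suc k)) \<subseteq> I (Suc k)" "ran (f (Suc k)) \<subseteq> J k"
    using limbs assms(1) by (simp_all add: numbered_limb_system_def)
  moreover have "f (Suc k) (fst c) = Some (snd c)"
    using assms by (auto simp: limb_def Map.graph_def)
  ultimately show ?thesis
    by (auto intro: ranI)
qed

lemma limb_odd:
  assumes "odd k" "c \<in> limb f g (Suc k)"
  shows "fst c \<in> I k \<and> snd c \<in> J (Suc k)"
proof -
  have "dom (g (Suc k)) \<subseteq> J (Suc k)" "ran (g (Suc k)) \<subseteq> I k"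
    using limbs assms(1) by (simp_all add: numbered_limb_system_def)
  moreover have "g (Suc k) (snd c) = Some (fst c)"
    using assms by (auto simp: limb_def antigraph_def)
  ultimately show ?thesis
    by (auto intro: ranI)
qed

lemma odd_pieces_disjoint:
  assumes "odd i" "odd j" "x \<in> I i" "x \<in> I j"
  shows "i = j"
proof -
  obtain a b where ab: "i = 2 * a + 1" "j = 2 * b + 1"
    using assms(1,2) by (metis oddE)
  have "disjoint_family (\<lambda>i. I (2 * i + 1))"
    using limbs by (simp only: numbered_limb_system_def)
  then have "a = b"
    using assms(3,4) unfolding ab disjoint_family_on_def by blast
  with ab show ?thesis by simp
qed

lemma even_pieces_disjoint:
  assumes "even i" "even j" "y \<in> J i" "y \<in> J j"
  shows "i = j"
proof -
  obtain a b where ab: "i = 2 * a" "j = 2 * b"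
    using assms(1,2) by (metis evenE)
  have "disjoint_family (\<lambda>i. J (2 * i))"
    using limbs by (simp only: numbered_limb_system_def)
  then have "a = b"
    using assms(3,4) unfolding ab disjoint_family_on_def by blast
  with ab show ?thesis by simp
qed

text \<open>For equal parity a common point lies in two pieces of the same decomposition. For
  \<open>i\<close> even and \<open>j\<close> odd, its first coordinate would force
  \<open>Suc i = j\<close> and its second \<open>i = Suc j\<close>.\<close>

lemma limb_disjoint:
  assumes "c \<in> limb f g (Suc i)" "c \<in> limb f g (Suc j)"
  shows "i = j"
proof -
  have "i = j" if "even i" "even j" "c \<in> limb f g (Suc i)" "c \<in> limb f g (Suc j)" for i j
    using limb_even[of i c] limb_even[of j c] that even_pieces_disjoint[of i j] by auto
  moreover have "i = j" if "odd i" "odd j" "c \<in> limb f g (Suc i)" "c \<in> limb f g (Suc j)" for i j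
    using limb_odd[of i c] limb_odd[of j c] that odd_pieces_disjoint[of i j] by auto
  moreover have False if "even i" "odd j" "c \<in> limb f g (Suc i)" "c \<in> limb f g (Suc j)" for i j
    using limb_even[of i c] limb_odd[of j c] that odd_pieces_disjoint[of "Suc i" j "fst c"]
      even_pieces_disjoint[of i "Suc j" "snd c"] by simp
  ultimately show ?thesis
    using assms by metis
qed

text \<open>The graph numbered \<open>Suc k\<close> lies over \<open>I (Suc k)\<close>. Any other
  limb with a point over this piece must be the antigraph of the next map, whose range lies in
  it.\<close>

lemma fst_limb_cases:
  assumes "even k" "c \<in> limb f g (Suc k)" "d \<in> limb f g (Suc i)" "fst d = fst c"
  shows "i = k \<or> i = Suc k"
proof (cases "even i")
  case True
  then show ?thesis
    using assms limb_even[of k c] limb_even[of i d] odd_pieces_disjoint[of "Suc i" "Suc k"] by auto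
next
  case False
  then show ?thesis
    using assms limb_even[of k c] limb_odd[of i d] odd_pieces_disjoint[of i "Suc k"] by auto
qed

lemma snd_limb_cases:
  assumes "odd k" "c \<in> limb f g (Suc k)" "d \<in> limb f g (Suc i)" "snd d = snd c"
  shows "i = k \<or> i = Suc k"
proof (cases "even i")
  case True
  then show ?thesis
    using assms limb_odd[of k c] limb_even[of i d] even_pieces_disjoint[of i "Suc k"] by auto
next
  case False
  then show ?thesis
    using assms limb_odd[of k c] limb_odd[of i d] even_pieces_disjoint[of "Suc i" "Suc k"] by auto
qed

end

section \<open>Vanishing of the variation along the limbs\<close>

text \<open>Serves to exclude that arbitrarily many disjoint limbs carry a fixed positive share of a
  finite measure.\<close>

lemma ennreal_const_series_bounded:
  fixes a C :: ennreal
  assumes bound: "\<And>n. of_nat n * a \<le> C" and C: "C < \<infinity>"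
  shows "a = 0"
proof (rule ccontr)
  assume "a \<noteq> 0"
  obtain c where c: "C = ennreal c" "0 \<le> c"
    using C by (cases C) auto
  obtain r where r: "a = ennreal r" "0 \<le> r"
    using bound[of 1] C by (cases a) (auto simp: top_unique)
  have "0 < r"
    using r \<open>a \<noteq> 0\<close> by (cases "r = 0") auto
  then obtain n :: nat where "c < real n * r"
    using reals_Archimedean3 by blast
  with bound[of n] c r show False
    by (simp add: ennreal_of_nat_eq_real_of_nat flip: ennreal_mult)
qed

text \<open>The limbs may fail to be Borel, so the chain of inequalities is run on Borel pieces
  \<open>A k\<close> of them that together carry \<open>m\<close>, and hence \<open>m0\<close>,
  \<open>m1\<close> and the variation.\<close>

lemma measures_eq_on_limb_system:
  fixes m m0 m1 :: "('a::polish_space \<times> 'b::polish_space) measure"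
  assumes limbs: "numbered_limb_system X Y I J f g S"
    and sets: "sets m = sets borel" "sets m0 = sets borel" "sets m1 = sets borel"
    and sigma_m: "sigma_finite_measure m"
    and ac: "absolutely_continuous m m0" "absolutely_continuous m m1"
    and marg_fst: "distr m0 borel fst = distr m1 borel fst" "sigma_finite_measure (distr m0 borel fst)"
    and marg_snd: "distr m0 borel snd = distr m1 borel snd" "sigma_finite_measure (distr m0 borel snd)"
    and A: "\<And>k. A k \<in> sets borel" "\<And>k. A k \<subseteq> limb f g (Suc k)"
    and ae: "AE c in m. c \<in> (\<Union>k. A k)"
    and fin: "finitely_many_limbs f g \<or> emeasure m0 UNIV < \<infinity> \<and> emeasure m1 UNIV < \<infinity>"
  shows "m0 = m1"
proof -
  obtain \<tau> P where \<tau>: "sets \<tau> = sets m" "P \<in> sets m" "absolutely_continuous m \<tau>"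
    and le: "\<And>B. B \<in> sets m \<Longrightarrow> emeasure m0 B \<le> emeasure m1 B + emeasure \<tau> B"
      "\<And>B. B \<in> sets m \<Longrightarrow> emeasure m1 B \<le> emeasure m0 B + emeasure \<tau> B"
    and eq: "\<And>B. B \<in> sets m \<Longrightarrow> B \<subseteq> P \<Longrightarrow> emeasure m0 B = emeasure m1 B + emeasure \<tau> B"
      "\<And>B. B \<in> sets m \<Longrightarrow> B \<inter> P = {} \<Longrightarrow> emeasure m1 B = emeasure m0 B + emeasure \<tau> B"
    using variation_measure_exists[OF sigma_m _ _ ac] sets by metis
  have sets_\<tau>: "sets \<tau> = sets borel"
    using \<tau>(1) sets(1) by simp
  have disj: "A i \<inter> A j = {}" if "i \<noteq> j" for i j
    using that A(2) limb_disjoint[OF limbs, of _ i j] by blast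
  have step: "emeasure \<tau> (A k) \<le> emeasure \<tau> (A (Suc k))" for k
  proof (cases "even k")
    case True
    have inj: "inj_on fst (A k)"
      using inj_on_fst_graph inj_on_subset A(2)[of k] True by (auto simp: limb_def)
    \<comment> \<open>Almost every point lies in some \<open>A i\<close>; if it shares its first
      coordinate with a point of \<open>A k\<close>, then \<open>i\<close> is \<open>k\<close> or
      \<open>Suc k\<close>.\<close>
    have ae_k: "AE c in m. fst c \<in> fst ` A k \<longrightarrow> c \<in> A k \<union> A (Suc k)"
      using ae
    proof (rule eventually_mono, safe)
      fix a b a' b' i
      assume "(a, b) \<in> A i" "(a', b') \<in> A k" "fst (a, b) = fst (a', b')" "(a, b) \<notin> A (Suc k)"
      then show "(a, b) \<in> A k"
        using fst_limb_cases[OF limbs True, of "(a', b')" "(a, b)" i] A(2) by blast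
    qed
    show ?thesis
      by (rule variation_le_next[OF sets sets_\<tau> sigma_m ac \<tau>(3) _ marg_fst _ A(1) A(1) _ inj ae_k])
        (use \<tau> le eq sets disj in \<open>auto intro: continuous_on_fst continuous_on_id\<close>)
  next
    case False
    have inj: "inj_on snd (A k)"
      using inj_on_snd_antigraph inj_on_subset A(2)[of k] False by (auto simp: limb_def)
    have ae_k: "AE c in m. snd c \<in> snd ` A k \<longrightarrow> c \<in> A k \<union> A (Suc k)"
      using ae
    proof (rule eventually_mono, safe)
      fix a b a' b' i
      assume "(a, b) \<in> A i" "(a', b') \<in> A k" "snd (a, b) = snd (a', b')" "(a, b) \<notin> A (Suc k)"
      then show "(a, b) \<in> A k"
        using snd_limb_cases[OF limbs False, of "(a', b')" "(a, b)" i] A(2) by blast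
    qed
    show ?thesis
      by (rule variation_le_next[OF sets sets_\<tau> sigma_m ac \<tau>(3) _ marg_snd _ A(1) A(1) _ inj ae_k])
        (use \<tau> le eq sets disj in \<open>auto intro: continuous_on_snd continuous_on_id\<close>)
  qed
  have mono: "emeasure \<tau> (A i) \<le> emeasure \<tau> (A j)" if "i \<le> j" for i j
    using lift_Suc_mono_le[of "\<lambda>k. emeasure \<tau> (A k)", OF step that] .
  have zero: "emeasure \<tau> (A k) = 0" for k
    using fin
  proof
    assume "finitely_many_limbs f g"
    then obtain N where N: "at_most_limbs N f g"
      by (auto simp: finitely_many_limbs_def)
    \<comment> \<open>The piece \<open>A j\<close> belongs to the limb \<open>Suc j\<close>, whose
      number exceeds \<open>N\<close>.\<close>
    define j where "j = max k N"
    have "limb f g (Suc j) = {}"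
      using N by (auto simp: at_most_limbs_def limb_def Map.graph_def antigraph_def j_def)
    then have "A j = {}"
      using A(2)[of j] by simp
    then show ?thesis
      using mono[of k j] by (simp add: j_def)
  next
    \<comment> \<open>On \<open>P\<close> the variation is at most \<open>m0\<close>, off
      \<open>P\<close> at most \<open>m1\<close>, so it is finite. Then, for every \<open>n\<close>,
      the \<open>n\<close> disjoint pieces from \<open>A k\<close> on, each at least as heavy as
      \<open>A k\<close>, fit into one finite mass.\<close>
    assume fin: "emeasure m0 UNIV < \<infinity> \<and> emeasure m1 UNIV < \<infinity>"
    have P: "P \<in> sets borel" "- P \<in> sets borel"
      using \<tau>(2) sets(1) by auto
    have "emeasure m0 P = emeasure m1 P + emeasure \<tau> P"
      "emeasure m1 (- P) = emeasure m0 (- P) + emeasure \<tau> (- P)"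
      using P by (auto intro!: eq simp: sets)
    moreover have "emeasure m0 P < \<infinity>" "emeasure m1 (- P) < \<infinity>"
      using fin emeasure_mono[of P UNIV m0] emeasure_mono[of "- P" UNIV m1]
      by (auto simp: sets intro: le_less_trans)
    ultimately have "emeasure \<tau> P + emeasure \<tau> (- P) < \<infinity>"
      by auto
    moreover have "emeasure \<tau> P + emeasure \<tau> (- P) = emeasure \<tau> (P \<union> - P)"
      using P by (intro plus_emeasure) (auto simp: sets_\<tau>)
    ultimately have fin_\<tau>: "emeasure \<tau> UNIV < \<infinity>"
      by simp
    show ?thesis
    proof (rule ennreal_const_series_bounded[OF _ fin_\<tau>])
      fix n
      have "of_nat n * emeasure \<tau> (A k) \<le> (\<Sum>j\<in>{k..<k + n}. emeasure \<tau> (A j))"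
        using sum_bounded_below[of "{k..<k + n}" "emeasure \<tau> (A k)" "\<lambda>j. emeasure \<tau> (A j)"] mono
        by simp
      also have "\<dots> = emeasure \<tau> (\<Union>j\<in>{k..<k + n}. A j)"
        using A(1) disj by (intro sum_emeasure) (auto simp: disjoint_family_on_def sets_\<tau>)
      also have "\<dots> \<le> emeasure \<tau> UNIV"
        by (intro emeasure_mono) (auto simp: sets_\<tau>)
      finally show "of_nat n * emeasure \<tau> (A k) \<le> emeasure \<tau> UNIV" .
    qed
  qed
  \<comment> \<open>The pieces are null for \<open>\<tau>\<close> and yet carry it, so
    \<open>\<tau>\<close> vanishes, and the two bounds \<open>le\<close> turn into equality of
    \<open>m0\<close> and \<open>m1\<close>.\<close>
  have "(\<Union>k. A k) \<in> null_sets \<tau>"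
    using zero A(1) by (intro null_sets_UN) (auto simp: null_sets_def sets_\<tau>)
  then have "AE c in \<tau>. c \<notin> (\<Union>k. A k)"
    by (rule AE_not_in)
  moreover have "AE c in \<tau>. c \<in> (\<Union>k. A k)"
    using absolutely_continuous_AE[OF _ \<tau>(3) ae] \<tau>(1) by simp
  ultimately have "AE c in \<tau>. False"
    by eventually_elim blast
  have \<tau>_null: "emeasure \<tau> B = 0" if "B \<in> sets borel" for B
  proof -
    have "AE c in \<tau>. c \<notin> B"
      using \<open>AE c in \<tau>. False\<close> by (rule eventually_mono) simp
    then show ?thesis
      using that AE_iff_null_sets[of B \<tau>] by (auto simp: sets_\<tau>)
  qed
  show ?thesis
  proof (rule measure_eqI)
    fix B assume "B \<in> sets m0"
    then show "emeasure m0 B = emeasure m1 B"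
      using le[of B] \<tau>_null[of B] by (simp add: sets)
  qed (simp add: sets)
qed

section \<open>Couplings on the ambient Polish space\<close>

text \<open>X and Y need not be Borel sets, so inner regularity is used for the extension of a coupling to the
  ambient Polish space rather than for the coupling.\<close>

abbreviation ambient :: "'a::topological_space measure \<Rightarrow> 'a measure"
  where "ambient \<gamma> \<equiv> distr \<gamma> borel (\<lambda>p. p)"

lemma ambient_measurable:
  assumes "sets \<gamma> = sets (restrict_space borel Z)"
  shows "(\<lambda>p. p) \<in> measurable \<gamma> borel"
  using measurable_restrict_space1[OF measurable_ident_sets[OF refl], of borel Z]
  by (simp add: measurable_cong_sets[OF assms refl])

lemma space_of_restrict:
  assumes "sets \<gamma> = sets (restrict_space borel Z)"
  shows "space \<gamma> = Z"
  using sets_eq_imp_space_eq[OF assms] by (simp add: space_restrict_space)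

lemma emeasure_ambient:
  assumes "sets \<gamma> = sets (restrict_space borel Z)" "B \<in> sets borel"
  shows "emeasure (ambient \<gamma>) B = emeasure \<gamma> (Z \<inter> B)"
  using emeasure_distr[OF ambient_measurable[OF assms(1)] assms(2)] space_of_restrict[OF assms(1)]
  by (simp add: Int_commute)

text \<open>Each measurable set of the subspace is the trace of a Borel set, on which the extension
  has the same value.\<close>

lemma ambient_inject:
  assumes sets: "sets \<gamma>0 = sets (restrict_space borel Z)" "sets \<gamma>1 = sets (restrict_space borel Z)"
    and eq: "ambient \<gamma>0 = ambient \<gamma>1"
  shows "\<gamma>0 = \<gamma>1"
proof (rule measure_eqI)
  fix B assume "B \<in> sets \<gamma>0"
  then obtain C where "B = Z \<inter> C" "C \<in> sets borel"
    by (auto simp: sets(1) sets_restrict_space)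
  then show "emeasure \<gamma>0 B = emeasure \<gamma>1 B"
    using emeasure_ambient[OF sets(1)] emeasure_ambient[OF sets(2)] eq by metis
qed (simp add: sets)

lemma sigma_finite_ambient:
  assumes sets: "sets \<gamma> = sets (restrict_space borel Z)" and "sigma_finite_measure \<gamma>"
  shows "sigma_finite_measure (ambient \<gamma>)"
proof -
  interpret sigma_finite_measure \<gamma> by fact
  obtain A :: "nat \<Rightarrow> 'a set" where A: "range A \<subseteq> sets \<gamma>" "(\<Union>i. A i) = space \<gamma>"
    "\<And>i. emeasure \<gamma> (A i) \<noteq> \<infinity>"
    using sigma_finite by blast
  have "\<exists>B. \<forall>i. A i = Z \<inter> B i \<and> B i \<in> sets borel"
    using A(1) by (intro choice) (auto simp: sets sets_restrict_space image_subset_iff)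
  then obtain B where B: "\<And>i. A i = Z \<inter> B i" "\<And>i. B i \<in> sets borel"
    by blast
  \<comment> \<open>The Borel sets \<open>B i\<close> cover \<open>Z\<close> but perhaps not the
    ambient space; the remainder misses \<open>Z\<close>, so it has mass zero and can be added to
    the cover.\<close>
  have rest: "- (\<Union>i. B i) \<in> sets borel"
    using B(2) by auto
  have "Z \<inter> - (\<Union>i. B i) = {}"
    using A(2) B(1) space_of_restrict[OF sets] by auto
  then have "emeasure (ambient \<gamma>) (- (\<Union>i. B i)) = 0"
    using emeasure_ambient[OF sets rest] by simp
  moreover have "emeasure (ambient \<gamma>) (B i) \<noteq> \<infinity>" for i
    using emeasure_ambient[OF sets B(2)] A(3) B(1) by metis
  ultimately show ?thesis
    using B(2) rest
    by unfold_locales (intro exI[of _ "insert (- (\<Union>i. B i)) (range B)"], auto)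
qed

lemma couplings_sets: "\<gamma> \<in> couplings X Y \<mu> \<nu> \<Longrightarrow> sets \<gamma> = sets (restrict_space borel (X \<times> Y))"
  by (simp add: couplings_def)

text \<open>Both sides are the push-forward of \<open>\<gamma>\<close> under \<open>p\<close> to the
  Borel sets of the ambient space.\<close>

lemma distr_ambient_marginal:
  fixes p :: "'c::topological_space \<Rightarrow> 'd::topological_space"
  assumes sets: "sets \<gamma> = sets (restrict_space borel Z)" and p: "continuous_on UNIV p" "p ` Z \<subseteq> W"
  shows "distr (ambient \<gamma>) borel p = ambient (distr \<gamma> (restrict_space borel W) p)"
proof -
  have p_borel: "p \<in> borel_measurable borel"
    using p(1) by (rule borel_measurable_continuous_onI)
  have p_\<gamma>: "p \<in> measurable \<gamma> (restrict_space borel W)"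
    using p(2) measurable_restrict_space1[OF p_borel, of Z]
    by (intro measurable_restrict_space2)
      (auto simp: space_of_restrict[OF sets] measurable_cong_sets[OF sets refl])
  have "distr (ambient \<gamma>) borel p = distr \<gamma> borel p"
    using distr_distr[OF p_borel ambient_measurable[OF sets]] by (simp add: comp_def)
  also have "\<dots> = ambient (distr \<gamma> (restrict_space borel W) p)"
    using distr_distr[OF ambient_measurable p_\<gamma>] by (simp add: comp_def)
  finally show ?thesis .
qed

lemma ambient_coupling_marginals:
  assumes "\<gamma> \<in> couplings X Y \<mu> \<nu>"
  shows "distr (ambient \<gamma>) borel fst = ambient \<mu>" "distr (ambient \<gamma>) borel snd = ambient \<nu>"
  using distr_ambient_marginal[OF couplings_sets[OF assms], of fst X]
    distr_ambient_marginal[OF couplings_sets[OF assms], of snd Y] assms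
  by (auto simp: couplings_def continuous_on_fst continuous_on_snd continuous_on_id)

text \<open>A push-forward keeps the total mass; thus finiteness of \<open>\<mu>\<close> passes to
  every coupling.\<close>

lemma emeasure_ambient_coupling_UNIV:
  assumes \<gamma>: "\<gamma> \<in> couplings X Y \<mu> \<nu>" and \<mu>: "sets \<mu> = sets (restrict_space borel X)"
  shows "emeasure (ambient \<gamma>) UNIV = emeasure \<mu> X"
proof -
  have "emeasure (ambient \<gamma>) UNIV = emeasure (distr (ambient \<gamma>) borel fst) UNIV"
    by (subst emeasure_distr)
      (auto intro!: borel_measurable_continuous_onI continuous_on_fst continuous_on_id
        simp: measurable_distr_eq1)
  also have "\<dots> = emeasure \<mu> X"
    using emeasure_ambient[OF \<mu>, of UNIV] by (simp add: ambient_coupling_marginals(1)[OF \<gamma>])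
  finally show ?thesis .
qed

text \<open>A set in the completion contains a Borel set that exhausts it up to a null set, and the
  part of the space off the limbs has a measurable null cover. Countably many null sets are
  discarded.\<close>

lemma AE_ambient_limbs:
  assumes sets: "sets \<gamma> = sets (restrict_space borel Z)"
    and vanish: "vanishes_outside \<gamma> (\<Union>k. L k)"
    and meas: "\<And>k::nat. measure_measurable \<gamma> (L k)"
  obtains A where "\<And>k. A k \<in> sets borel" "\<And>k. A k \<subseteq> L k" "AE c in ambient \<gamma>. c \<in> (\<Union>k. A k)"
proof -
  have "\<exists>A N. A \<in> sets borel \<and> N \<in> null_sets (ambient \<gamma>) \<and> A \<subseteq> L k \<and> L k \<subseteq> A \<union> N" for k
    using meas[of k] unfolding measure_measurable_def
    by (elim sets_completionE) (intro exI conjI, auto)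
  then obtain A N where A: "\<And>k. A k \<in> sets borel" "\<And>k. A k \<subseteq> L k"
    and N: "\<And>k. N k \<in> null_sets (ambient \<gamma>)" "\<And>k. L k \<subseteq> A k \<union> N k"
    by metis
  obtain E where E: "E \<in> sets \<gamma>" "space \<gamma> - (\<Union>k. L k) \<subseteq> E" "emeasure \<gamma> E = 0"
    using outer_measure_of_attain[of "space \<gamma> - (\<Union>k. L k)" \<gamma>] vanish
    by (auto simp: vanishes_outside_def)
  obtain F where F: "E = Z \<inter> F" "F \<in> sets borel"
    using E(1) by (auto simp: sets sets_restrict_space)
  \<comment> \<open>A point of \<open>Z\<close> lies either in some \<open>L k\<close>, hence in
    \<open>A k\<close> or \<open>N k\<close>, or off all of them, hence in \<open>F\<close>. So
    \<open>C\<close> misses \<open>Z\<close> and is null for the extension.\<close>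
  define C where "C = - (\<Union>k. A k) - F - (\<Union>k. N k)"
  have N_borel: "N k \<in> sets borel" for k
    using N(1)[of k] by auto
  have C: "C \<in> sets borel"
    using A(1) F(2) N_borel unfolding C_def by auto
  have "Z \<inter> C = {}"
    using E(2) F(1) N(2) space_of_restrict[OF sets] unfolding C_def by blast
  then have "C \<in> null_sets (ambient \<gamma>)"
    using emeasure_ambient[OF sets C] C by (simp add: null_sets_def)
  moreover have "F \<in> null_sets (ambient \<gamma>)"
    using emeasure_ambient[OF sets F(2)] E(3) F by (simp add: null_sets_def)
  moreover have "(\<Union>k. N k) \<in> null_sets (ambient \<gamma>)"
    using N(1) by (rule null_sets_UN)
  ultimately have "C \<union> F \<union> (\<Union>k. N k) \<in> null_sets (ambient \<gamma>)"
    by (intro null_sets.Un)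
  then have "AE c in ambient \<gamma>. c \<in> (\<Union>k. A k)"
    by (rule AE_I') (auto simp: C_def)
  with A that show thesis by blast
qed

section \<open>Extremality by way of the ambient extensions\<close>

theorem corollary3p3:
  fixes X :: "'a::polish_space set" and Y :: "'b::polish_space set"
    and \<mu> :: "'a measure" and \<nu> :: "'b measure"
    and I :: "nat \<Rightarrow> 'a set" and J :: "nat \<Rightarrow> 'b set"
    and f :: "nat \<Rightarrow> 'a \<rightharpoonup> 'b" and g :: "nat \<Rightarrow> 'b \<rightharpoonup> 'a"
    and S :: "('a \<times> 'b) set" and \<gamma> :: "('a \<times> 'b) measure"
  assumes "sets \<mu> = sets (restrict_space borel X)" and "sigma_finite_measure \<mu>"
    and "sets \<nu> = sets (restrict_space borel Y)" and "sigma_finite_measure \<nu>"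
    and "numbered_limb_system X Y I J f g S"
    and "\<And>\<gamma>' i. \<gamma>' \<in> couplings X Y \<mu> \<nu> \<Longrightarrow> vanishes_outside \<gamma>' S \<Longrightarrow> 1 \<le> i \<Longrightarrow>
           measure_measurable \<gamma>' (Map.graph (f (2 * i - 1))) \<and> measure_measurable \<gamma>' (antigraph (g (2 * i)))"
    and "finitely_many_limbs f g \<or> emeasure \<mu> X < \<infinity>"
    and "\<gamma> \<in> couplings X Y \<mu> \<nu>" and "vanishes_outside \<gamma> S"
  shows "extremal_in \<gamma> (couplings X Y \<mu> \<nu>)"
proof -
  have S_limbs: "S = (\<Union>k. limb f g (Suc k))"
    using assms(5) by (simp add: numbered_limb_system_def limb_union_eq)
  \<comment> \<open>Measurability is assumed for pairs of limbs numbered from \<open>i = 1\<close>;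
    both \<open>k = 2 * j\<close> and \<open>k = 2 * j + 1\<close> belong to the pair
    \<open>i = Suc j\<close>.\<close>
  have limb_meas: "measure_measurable \<gamma> (limb f g (Suc k))" for k
  proof (cases "even k")
    case True
    then obtain j where "k = 2 * j" by (rule evenE)
    then show ?thesis
      using assms(6)[OF assms(8,9), of "Suc j"] by (simp add: limb_def)
  next
    case False
    then obtain j where "k = 2 * j + 1" by (rule oddE)
    then show ?thesis
      using assms(6)[OF assms(8,9), of "Suc j"] by (simp add: limb_def)
  qed
  obtain A where A: "\<And>k. A k \<in> sets borel" "\<And>k. A k \<subseteq> limb f g (Suc k)"
    "AE c in ambient \<gamma>. c \<in> (\<Union>k. A k)"
    using AE_ambient_limbs[OF couplings_sets[OF assms(8)] assms(9)[unfolded S_limbs] limb_meas] by blast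
  have sigma_\<mu>: "sigma_finite_measure (ambient \<mu>)" and sigma_\<nu>: "sigma_finite_measure (ambient \<nu>)"
    using assms(1-4) by (auto intro: sigma_finite_ambient)
  have "fst \<in> measurable (ambient \<gamma>) borel"
    by (auto intro!: borel_measurable_continuous_onI continuous_on_fst continuous_on_id
        simp: measurable_distr_eq1)
  \<comment> \<open>Preimages of sets of finite mass for the first marginal have finite mass for the
    coupling.\<close>
  then have sigma_\<gamma>: "sigma_finite_measure (ambient \<gamma>)"
    using sigma_\<mu> by (intro sigma_finite_measure_distr[of "ambient \<gamma>" borel fst])
      (simp_all add: ambient_coupling_marginals(1)[OF assms(8)])
  have "\<gamma>0 = \<gamma>1"
    if t: "0 < t" "t < 1" and \<gamma>01: "\<gamma>0 \<in> couplings X Y \<mu> \<nu>" "\<gamma>1 \<in> couplings X Y \<mu> \<nu>"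
      and comb: "\<And>B. B \<in> sets \<gamma> \<Longrightarrow>
        emeasure \<gamma> B = ennreal (1 - t) * emeasure \<gamma>0 B + ennreal t * emeasure \<gamma>1 B"
    for t :: real and \<gamma>0 \<gamma>1
  proof (rule ambient_inject[OF \<gamma>01[THEN couplings_sets]])
    have "emeasure (ambient \<gamma>) B = ennreal (1 - t) * emeasure (ambient \<gamma>0) B + ennreal t * emeasure (ambient \<gamma>1) B"
      if "B \<in> sets borel" for B
      using that comb[of "(X \<times> Y) \<inter> B"] emeasure_ambient[OF couplings_sets that] assms(8) \<gamma>01
      by (auto simp: couplings_sets[OF assms(8)] sets_restrict_space)
    \<comment> \<open>Both weights \<open>1 - t\<close> and \<open>t\<close> are positive, so a null
      set of the combination is null for each summand.\<close>
    then have ac: "absolutely_continuous (ambient \<gamma>) (ambient \<gamma>0)"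
      "absolutely_continuous (ambient \<gamma>) (ambient \<gamma>1)"
      using t by (auto simp: absolutely_continuous_def null_sets_def ennreal_eq_0_iff)
    have fin: "finitely_many_limbs f g \<or>
        emeasure (ambient \<gamma>0) UNIV < \<infinity> \<and> emeasure (ambient \<gamma>1) UNIV < \<infinity>"
      using assms(7) emeasure_ambient_coupling_UNIV[OF \<gamma>01(1) assms(1)]
        emeasure_ambient_coupling_UNIV[OF \<gamma>01(2) assms(1)] by simp
    show "ambient \<gamma>0 = ambient \<gamma>1"
      using sigma_\<mu> sigma_\<nu> A
      by (intro measures_eq_on_limb_system[OF assms(5) _ _ _ sigma_\<gamma> ac _ _ _ _ _ _ _ fin])
        (auto simp: ambient_coupling_marginals[OF \<gamma>01(1)] ambient_coupling_marginals[OF \<gamma>01(2)])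
  qed
  then show ?thesis
    using assms(8) unfolding extremal_in_def by blast
qed

end
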